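(* Let $v\geq 3$ with $v\equiv 0,1 \pmod 3$. If $v\in\{3,4,6\}$, then every DTS$(v)$ has a $v$-good sequencing; if $v\geq 7$, then there exists a DTS$(v)$ that has no $v$-good sequencing.
   Context: A transitive triple is an ordered triple $(x,y,z)$ of distinct elements; it contains the directed edges $(x,y)$, $(x,z)$, $(y,z)$. A directed triple system of order $v$, DTS$(v)$, is a pair $(X,\mathcal{B})$ where $X$ is a set of $v$ points and $\mathcal{B}$ is a set of transitive triples of elements of $X$ such that every ordered pair $(a,b)$ of distinct points of $X$ occurs as a directed edge in exactly one triple of $\mathcal{B}$. A $v$-good sequencing of a DTS$(v)$ $(X,\mathcal{B})$ is a permutation $[x_1\, x_2\, \cdots\, x_v]$ of $X$ such that for no triple $(x,y,z)\in\mathcal{B}$ do we have $x=x_i$, $y=x_j$, $z=x_k$ with $i<j<k$. *)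

theory Defs
  imports Main "HOL-Combinatorics.Multiset_Permutations"
begin

definition transitive_triple :: "'a \<times> 'a \<times> 'a \<Rightarrow> bool" where
  "transitive_triple = (\<lambda>(x, y, z). x \<noteq> y \<and> x \<noteq> z \<and> y \<noteq> z)"

definition triple_edges :: "'a \<times> 'a \<times> 'a \<Rightarrow> ('a \<times> 'a) set" where
  "triple_edges = (\<lambda>(x, y, z). {(x, y), (x, z), (y, z)})"

definition directed_triple_system ::
    "nat \<Rightarrow> 'a set \<Rightarrow> ('a \<times> 'a \<times> 'a) set \<Rightarrow> bool" where
  "directed_triple_system v X B \<longleftrightarrow>
     finite X \<and> card X = v \<and>
     (\<forall>t\<in>B. transitive_triple t \<and> t \<in> X \<times> X \<times> X) \<and>
     (\<forall>a\<in>X. \<forall>b\<in>X. a \<noteq> b \<longrightarrow> (\<exists>!t. t \<in> B \<and> (a, b) \<in> triple_edges t))"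

(* The v-good sequencings of a DTS(v): the sequencing [x_1 ... x_v] is a list, with positions
   counted from 0. The order v is card X and is not repeated as a parameter. *)
definition good_sequencing :: "'a set \<Rightarrow> ('a \<times> 'a \<times> 'a) set \<Rightarrow> 'a list \<Rightarrow> bool" where
  "good_sequencing X B xs \<longleftrightarrow>
     xs \<in> permutations_of_set X \<and>
     \<not> (\<exists>(x, y, z)\<in>B. \<exists>i j k. i < j \<and> j < k \<and> k < length xs \<and>
          x = xs ! i \<and> y = xs ! j \<and> z = xs ! k)"

end

theory Submission
  imports Defs "HOL-Library.Sublist" "HOL-Number_Theory.Cong"
begin

text \<open>
  For orders 3, 4 and 6, assume that every sequencing violates a triple and rename the points so
  that \<open>(0, 1, 2)\<close> is a triple. Each ordered pair and each sequencing then forces one of a few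
  triples that are edge-disjoint from those already chosen, and a small search tree closes.

  For orders at least 7, a system containing a subsystem without good sequencing has none either.
  A system of order \<open>v\<close> embeds into systems of orders \<open>2v + 1\<close> and \<open>2v + 4\<close>: the new points are
  the integers modulo \<open>v + 1\<close> or \<open>v + 4\<close>, each old point is placed in the middle of all edges of
  one fixed difference, and in the second case the differences 1, 2, 3 are used up by the triples
  \<open>(i, i + 1, i + 3)\<close>. This leaves the orders 7, 9, 10, 12, 13 and 16. Order 16 is again settled by
  a subsystem of order 7. For the others, whether a point can be appended to an initial segment of
  a good sequencing depends only on the set of points in that segment, and for suitable systems few
  sets are reachable.
\<close>

section \<open>Good sequencings and subsequences\<close>

text \<open>Trades the indices of the definition for the sublist order, in which deleting points and
  composing embeddings are immediate.\<close>

lemma subseq_triple_iff: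
  "subseq [x, y, z] xs \<longleftrightarrow>
     (\<exists>i j k. i < j \<and> j < k \<and> k < length xs \<and> x = xs ! i \<and> y = xs ! j \<and> z = xs ! k)"
proof
  assume "subseq [x, y, z] xs"
  from list_emb_ConsD[OF this] obtain as us where us: "xs = as @ x # us" "subseq [y, z] us"
    by blast
  from list_emb_ConsD[OF us(2)] obtain bs vs where vs: "us = bs @ y # vs" "subseq [z] vs"
    by blast
  from list_emb_ConsD[OF vs(2)] obtain cs ws where ws: "vs = cs @ z # ws"
    by blast
  let ?i = "length as" and ?j = "length as + 1 + length bs"
  let ?k = "length as + 1 + length bs + 1 + length cs"
  have "xs = as @ [x] @ bs @ [y] @ cs @ [z] @ ws"
    using us vs ws by simp
  then have "x = xs ! ?i \<and> y = xs ! ?j \<and> z = xs ! ?k \<and> ?k < length xs"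
    by (simp add: nth_append)
  then show "\<exists>i j k. i < j \<and> j < k \<and> k < length xs \<and> x = xs ! i \<and> y = xs ! j \<and> z = xs ! k"
    by (intro exI[of _ ?i] exI[of _ ?j] exI[of _ ?k]) simp
next
  assume "\<exists>i j k. i < j \<and> j < k \<and> k < length xs \<and> x = xs ! i \<and> y = xs ! j \<and> z = xs ! k"
  then obtain i j k where ijk: "i < j" "j < k" "k < length xs"
    and [simp]: "x = xs ! i" "y = xs ! j" "z = xs ! k"
    by blast
  have "xs = take i xs @ x # drop (Suc i) xs"
    using ijk by (simp add: id_take_nth_drop)
  moreover have "drop (Suc i) xs = take (j - Suc i) (drop (Suc i) xs) @ y # drop (Suc j) xs"
    using ijk id_take_nth_drop[of "j - Suc i" "drop (Suc i) xs"] by simp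
  moreover have "drop (Suc j) xs = take (k - Suc j) (drop (Suc j) xs) @ z # drop (Suc k) xs"
    using ijk id_take_nth_drop[of "k - Suc j" "drop (Suc j) xs"] by simp
  ultimately obtain as bs cs ds where "xs = as @ x # bs @ y # cs @ z # ds"
    by metis
  moreover have "subseq [x', y', z'] (as @ x' # bs @ y' # cs @ z' # ds)" for x' y' z'
    by (simp add: list_emb_append2)
  ultimately show "subseq [x, y, z] xs"
    by metis
qed

lemma good_sequencing_iff:
  "good_sequencing X B xs \<longleftrightarrow>
     set xs = X \<and> distinct xs \<and> (\<forall>x y z. (x, y, z) \<in> B \<longrightarrow> \<not> subseq [x, y, z] xs)"
  unfolding good_sequencing_def subseq_triple_iff permutations_of_set_def by blast

text \<open>Deleting points creates no new subsequence. Read contrapositively, this carries the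
  absence of good sequencings from a subsystem to the whole system.\<close>

lemma good_sequencing_restrict:
  assumes "good_sequencing X B xs" "X' \<subseteq> X" "B' \<subseteq> B"
  shows "good_sequencing X' B' (filter (\<lambda>x. x \<in> X') xs)"
proof -
  have "\<not> subseq [x, y, z] (filter (\<lambda>x. x \<in> X') xs)" if "(x, y, z) \<in> B'" for x y z
    using assms that subseq_filter_left subseq_order.trans unfolding good_sequencing_iff by blast
  then show ?thesis
    using assms unfolding good_sequencing_iff by auto
qed

lemma directed_triple_system_edge:
  assumes "directed_triple_system v X B" "a \<in> X" "b \<in> X" "a \<noteq> b"
  obtains c where "c \<in> X" "c \<noteq> a" "c \<noteq> b" "(c, a, b) \<in> B \<or> (a, c, b) \<in> B \<or> (a, b, c) \<in> B"
proof -
  obtain t where "t \<in> B" "(a, b) \<in> triple_edges t"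
    using assms unfolding directed_triple_system_def by blast
  moreover have "transitive_triple t \<and> t \<in> X \<times> X \<times> X"
    using assms(1) \<open>t \<in> B\<close> unfolding directed_triple_system_def by blast
  ultimately show ?thesis
    by (cases t) (auto simp: triple_edges_def transitive_triple_def intro: that)
qed

lemma directed_triple_system_unique:
  assumes "directed_triple_system v X B" "s \<in> B" "t \<in> B" "e \<in> triple_edges s" "e \<in> triple_edges t"
  shows "s = t"
proof -
  have "transitive_triple s \<and> s \<in> X \<times> X \<times> X"
    using assms(1,2) unfolding directed_triple_system_def by blast
  then have "fst e \<in> X \<and> snd e \<in> X \<and> fst e \<noteq> snd e"
    using assms(4) by (cases s) (auto simp: triple_edges_def transitive_triple_def)
  then obtain a b where "e = (a, b)" "a \<in> X" "b \<in> X" "a \<noteq> b"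
    by (cases e) auto
  then have "\<exists>!t. t \<in> B \<and> e \<in> triple_edges t"
    using assms(1) unfolding directed_triple_system_def by blast
  then show ?thesis
    using assms(2-5) by blast
qed

section \<open>Small orders\<close>

fun pairs_of :: "'a list \<Rightarrow> ('a \<times> 'a) list" where
  "pairs_of [] = []"
| "pairs_of (x # xs) = map (Pair x) xs @ pairs_of xs"

fun triples_of :: "'a list \<Rightarrow> ('a \<times> 'a \<times> 'a) list" where
  "triples_of [] = []"
| "triples_of (x # xs) = map (Pair x) (pairs_of xs) @ triples_of xs"

lemma set_pairs_of: "(x, y) \<in> set (pairs_of xs) \<longleftrightarrow> subseq [x, y] xs"
  by (induction xs) (auto simp: subseq_singleton_left dest: subseq_Cons')

lemma set_triples_of: "(x, y, z) \<in> set (triples_of xs) \<longleftrightarrow> subseq [x, y, z] xs"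
  by (induction xs) (auto simp: set_pairs_of dest: subseq_Cons')

lemma pairs_of_map: "pairs_of (map f xs) = map (map_prod f f) (pairs_of xs)"
  by (induction xs) auto

lemma triples_of_map: "triples_of (map f xs) = map (map_prod f (map_prod f f)) (triples_of xs)"
  by (induction xs) (auto simp: pairs_of_map)

text \<open>
  A node of a search tree carries either an ordered pair, whose covering triple is guessed, or a
  sequencing, whose violated triple is guessed.
\<close>

datatype search_tree = Branch "nat list" "search_tree list"

text \<open>A two-element list is read as an ordered pair and every other list as a sequencing. The
  readings do not collide for the orders 3, 4 and 6 treated here.\<close>

fun candidates :: "nat \<Rightarrow> nat list \<Rightarrow> (nat \<times> nat \<times> nat) list" where
  "candidates v [a, b] =
     concat (map (\<lambda>c. if c = a \<or> c = b then [] else [(c, a, b), (a, c, b), (a, b, c)]) [0..<v])"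
| "candidates v ps = triples_of ps"

fun valid_node :: "nat \<Rightarrow> nat list \<Rightarrow> bool" where
  "valid_node v [a, b] \<longleftrightarrow> a \<noteq> b \<and> a < v \<and> b < v"
| "valid_node v ps \<longleftrightarrow> distinct ps \<and> length ps = v \<and> list_all (\<lambda>p. p < v) ps"

text \<open>Distinct entries leave only these coincidences of edges to exclude. Equality is allowed
  because the guessed triple may be one chosen earlier.\<close>

fun compatible :: "nat \<times> nat \<times> nat \<Rightarrow> nat \<times> nat \<times> nat \<Rightarrow> bool" where
  "compatible (x, y, z) (x', y', z') \<longleftrightarrow>
     (x = x' \<and> y = y' \<and> z = z') \<or>
     (if x = x' then y \<noteq> y' \<and> y \<noteq> z' \<and> z \<noteq> y' \<and> z \<noteq> z'
      else if x = y' then y \<noteq> z' \<and> z \<noteq> z'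
      else if y = x' then z \<noteq> y' \<and> z \<noteq> z'
      else \<not> (y = y' \<and> z = z'))"

text \<open>Children are matched by position with the candidates that survive the filter. A node
  without children is thus accepted only if every candidate clashes with a triple in
  \<open>S\<close>.\<close>

fun refutes :: "nat \<Rightarrow> (nat \<times> nat \<times> nat) list \<Rightarrow> search_tree \<Rightarrow> bool"
and refutes_all :: "nat \<Rightarrow> (nat \<times> nat \<times> nat) list \<Rightarrow> (nat \<times> nat \<times> nat) list \<Rightarrow>
    search_tree list \<Rightarrow> bool" where
  "refutes v S (Branch ps bs) \<longleftrightarrow> valid_node v ps \<and>
     refutes_all v S (filter (\<lambda>t. list_all (compatible t) S) (candidates v ps)) bs"
| "refutes_all v S [] bs \<longleftrightarrow> True"
| "refutes_all v S (t # ts) [] \<longleftrightarrow> False"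
| "refutes_all v S (t # ts) (b # bs) \<longleftrightarrow> refutes v (t # S) b \<and> refutes_all v S ts bs"

section \<open>Soundness of the search trees\<close>

lemma compatible_iff:
  assumes "transitive_triple s" "transitive_triple t"
  shows "compatible s t \<longleftrightarrow> s = t \<or> triple_edges s \<inter> triple_edges t = {}"
  using assms by (cases s; cases t) (auto simp: transitive_triple_def triple_edges_def)

text \<open>A pair is covered by some triple of the system; a sequencing is not good by assumption,
  so some triple occurs in it in order. Either way a candidate is realised under the renaming
  \<open>f\<close>.\<close>

lemma valid_node_candidate:
  assumes D: "directed_triple_system v X B" and f: "bij_betw f {..<v} X"
    and bad: "\<nexists>xs. good_sequencing X B xs" and node: "valid_node v ps"
  shows "\<exists>(i, j, k)\<in>set (candidates v ps). i < v \<and> j < v \<and> k < v \<and> (f i, f j, f k) \<in> B"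
proof (cases "\<exists>a b. ps = [a, b]")
  case True
  then obtain a b where ps: "ps = [a, b]" "a \<noteq> b" "a < v" "b < v"
    using node by auto
  then have "f a \<in> X" "f b \<in> X" "f a \<noteq> f b"
    using f unfolding bij_betw_def inj_on_def by auto
  then obtain c' where c': "c' \<in> X" "c' \<noteq> f a" "c' \<noteq> f b"
      "(c', f a, f b) \<in> B \<or> (f a, c', f b) \<in> B \<or> (f a, f b, c') \<in> B"
    by (rule directed_triple_system_edge[OF D])
  then obtain c where "c < v" "c' = f c"
    using f unfolding bij_betw_def by auto
  with c' ps show ?thesis
    by fastforce
next
  case False
  then have "valid_node v ps \<longleftrightarrow> distinct ps \<and> length ps = v \<and> (\<forall>p\<in>set ps. p < v)"
    and "candidates v ps = triples_of ps"
    by (cases "(v, ps)" rule: valid_node.cases; simp add: list_all_iff)+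
  then have ps: "distinct ps" "length ps = v" "\<forall>p\<in>set ps. p < v" "candidates v ps = triples_of ps"
    using node by auto
  then have "set ps = {..<v}"
    by (intro card_subset_eq) (auto simp: distinct_card)
  then have "set (map f ps) = X" "distinct (map f ps)"
    using f ps unfolding bij_betw_def by (auto simp: distinct_map)
  then obtain t where t: "t \<in> B" "t \<in> set (triples_of (map f ps))"
    using bad unfolding good_sequencing_iff set_triples_of[symmetric] by blast
  then obtain i j k where "(i, j, k) \<in> set (triples_of ps)" "t = (f i, f j, f k)"
    unfolding triples_of_map by auto
  moreover have "p \<in> set ps" if "subseq [i, j, k] ps" "p \<in> set [i, j, k]" for i j k p
    using list_emb_set[OF that] by metis
  ultimately show ?thesis
    using t ps unfolding set_triples_of by (intro bexI[of _ "(i, j, k)"]) (auto simp: set_triples_of)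
qed

lemma refutes_allD:
  "refutes_all v S ts bs \<Longrightarrow> t \<in> set ts \<Longrightarrow> \<exists>b\<in>set bs. refutes v (t # S) b"
proof (induction ts arbitrary: bs)
  case (Cons t ts)
  then show ?case
    by (cases bs) auto
qed simp

text \<open>The invariant \<open>Q\<close> says that the chosen triples really belong to the system.
  They are then pairwise compatible, so the realised candidate is never filtered out and the descent
  cannot end, although the tree is finite.\<close>

lemma refutes_sound:
  fixes f :: "nat \<Rightarrow> 'a"
  assumes D: "directed_triple_system v X B" and f: "bij_betw f {..<v} X"
    and bad: "\<nexists>xs. good_sequencing X B xs"
  defines "Q \<equiv> \<lambda>(i, j, k). i < v \<and> j < v \<and> k < v \<and> (f i, f j, f k) \<in> B"
  assumes "refutes v S b" "\<forall>s\<in>set S. Q s"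
  shows False
proof -
  have inj: "inj_on f {..<v}"
    using f by (simp add: bij_betw_def)
  have Q_compatible: "compatible s t" if "Q s" "Q t" for s t
  proof -
    obtain i j k i' j' k' where st: "s = (i, j, k)" "t = (i', j', k')"
      by (metis prod_cases3)
    let ?s = "(f i, f j, f k)" and ?t = "(f i', f j', f k')"
    have B: "?s \<in> B" "?t \<in> B"
      using that st by (auto simp: Q_def)
    then have "transitive_triple ?s" "transitive_triple ?t"
      using D unfolding directed_triple_system_def by blast+
    then have tt: "transitive_triple s" "transitive_triple t"
      using st by (auto simp: transitive_triple_def)
    have "s = t" if "(a, b) \<in> triple_edges s" "(a, b) \<in> triple_edges t" for a b
    proof -
      have "(f a, f b) \<in> triple_edges ?s" "(f a, f b) \<in> triple_edges ?t"
        using that st by (auto simp: triple_edges_def)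
      then have "?s = ?t"
        using directed_triple_system_unique[OF D B] by blast
      then show ?thesis
        using \<open>Q s\<close> \<open>Q t\<close> st inj by (auto simp: Q_def inj_on_def)
    qed
    then have "s = t \<or> triple_edges s \<inter> triple_edges t = {}"
      by (metis disjoint_iff surj_pair)
    then show ?thesis
      using compatible_iff[OF tt] by simp
  qed
  show False
    using assms(5,6)
  proof (induction b arbitrary: S)
    case (Branch ps bs)
    obtain t where t: "t \<in> set (candidates v ps)" "Q t"
      using valid_node_candidate[OF D f bad, of ps] Branch.prems(1) unfolding Q_def by auto
    then have "t \<in> set (filter (\<lambda>t. list_all (compatible t) S) (candidates v ps))"
      using Branch.prems(2) Q_compatible by (auto simp: list_all_iff)
    then obtain b where "b \<in> set bs" "refutes v (t # S) b"
      using refutes_allD Branch.prems(1) unfolding refutes.simps by blast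
    then show ?case
      using Branch.IH[of b "t # S"] Branch.prems(2) t(2) by simp
  qed
qed

lemma good_sequencing_if_refutes:
  fixes X :: "'a set"
  assumes D: "directed_triple_system v X B" and "v \<ge> 3" and r: "refutes v [(0, 1, 2)] b"
  shows "\<exists>xs. good_sequencing X B xs"
proof (rule ccontr)
  assume bad: "\<nexists>xs. good_sequencing X B xs"
  have X: "finite X" "card X = v"
    using D by (auto simp: directed_triple_system_def)
  then have "\<not> card X \<le> Suc 0"
    using \<open>v \<ge> 3\<close> by simp
  then obtain a b where "a \<in> X" "b \<in> X" "a \<noteq> b"
    using X(1) card_le_Suc0_iff_eq by blast
  then obtain t where "t \<in> B"
    using D unfolding directed_triple_system_def by blast
  then obtain x y z where t: "(x, y, z) \<in> B"
    by (cases t) auto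
  then have xyz: "transitive_triple (x, y, z)" "(x, y, z) \<in> X \<times> X \<times> X"
    using D unfolding directed_triple_system_def by blast+
  obtain zs where zs: "set zs = X - {x, y, z}" "distinct zs"
    using X finite_distinct_list by (metis finite_Diff)
  \<comment> \<open>Renaming points by their positions in this list turns the given triple into
    \<open>(0, 1, 2)\<close>.\<close>
  let ?xs = "x # y # z # zs"
  have xs: "distinct ?xs" "set ?xs = X"
    using zs xyz by (auto simp: transitive_triple_def)
  then have "length ?xs = v"
    using X distinct_card by metis
  then have "bij_betw ((!) ?xs) {..<v} X"
    using xs bij_betw_nth by metis
  from refutes_sound[OF D this bad r] show False
    using t \<open>v \<ge> 3\<close> by (simp add: numeral_2_eq_2)
qed

section \<open>Search trees for the orders 3, 4 and 6\<close>

lemma good_sequencing_order_3: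
  "directed_triple_system 3 X B \<Longrightarrow> \<exists>xs. good_sequencing X B xs"
proof (erule good_sequencing_if_refutes)
  \<comment> \<open>The only candidate \<open>(1, 2, 0)\<close> repeats the edge
    \<open>(1, 2)\<close>.\<close>
  show "refutes 3 [(0, 1, 2)] (Branch [1,2,0] [])"
    by code_simp
qed simp

lemma good_sequencing_order_4:
  "directed_triple_system 4 X B \<Longrightarrow> \<exists>xs. good_sequencing X B xs"
proof (erule good_sequencing_if_refutes)
  \<comment> \<open>The first sequencing forces \<open>(1, 0, 3)\<close>; after that, every triple
    along the second one repeats an edge.\<close>
  show "refutes 4 [(0, 1, 2)] (Branch [1,0,3,2] [Branch [0,2,1,3] []])"
    by code_simp
qed simp

lemma good_sequencing_order_6:
  "directed_triple_system 6 X B \<Longrightarrow> \<exists>xs. good_sequencing X B xs"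
proof (erule good_sequencing_if_refutes)
  \<comment> \<open>The root pair \<open>(0, 3)\<close> has eight covering triples that avoid the
    edges of \<open>(0, 1, 2)\<close>, one for each subtree.\<close>
  show "refutes 6 [(0, 1, 2)] (
  Branch [0,3] [Branch [1,4] [Branch [1,5] [Branch [0,2,4,1,3,5] [Branch [2,4,0,1,3,5] []],
  Branch [0,2,4,5,1,3] [Branch [4,0,5,2,3,1] []]], Branch [1,5] [Branch [0,2,5,1,3,4] [Branch
  [3,4,1,0,2,5] []], Branch [0,2,1,3,4,5] [Branch [0,2,4,5,3,1] []]], Branch [0,5,4,2,1,3]
  [Branch [0,2,1,5,4,3] [Branch [0,2,5,4,1,3] []], Branch [1,5] [Branch [0,3,2,5,4,1] [Branch
  [1,3,0,5,4,2] []]], Branch [0,2,1,5,4,3] [Branch [0,2,5,4,3,1] []]], Branch [5,0,2,1,4,3]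
  [Branch [0,2,5,1,3,4] [Branch [0,2,3,5,1,4] [], Branch [0,2,5,4,1,3] []], Branch
  [0,2,5,1,3,4] [Branch [5,0,3,2,1,4] [Branch [0,5,3,4,2,1] []]], Branch [0,2,5,1,3,4] [Branch
  [5,4,0,2,3,1] []]], Branch [0,4,2,1,5,3] [Branch [0,2,4,5,1,3] [Branch [0,2,3,4,1,5] [],
  Branch [0,2,4,1,3,5] []], Branch [0,2,4,1,3,5] [Branch [5,0,2,1,4,3] [Branch [0,2,1,5,4,3]
  []]], Branch [0,4,2,1,3,5] [Branch [0,2,4,1,3,5] []]]], Branch [0,4] [Branch [0,5] [Branch
  [1,4,0,2,3,5] [Branch [1,4,3,5,0,2] []], Branch [1,4,5,0,2,3] [Branch [0,2,1,4,3,5] []]],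
  Branch [0,5] [Branch [1,5,0,2,3,4] [Branch [1,2,3,5,4,0] []], Branch [1,0,2,3,4,5] [Branch
  [4,1,5,0,2,3] []]], Branch [1,0,5,2,4,3] [Branch [1,5,4,0,2,3] [Branch [2,3,0,1,5,4] []],
  Branch [1,0,2,3,5,4] [], Branch [1,2,3,5,4,0] [Branch [5,4,1,0,2,3] []]], Branch
  [5,1,0,4,2,3] [Branch [5,4,0,2,3,1] [Branch [2,3,5,0,4,1] [], Branch [2,3,5,0,4,1] []],
  Branch [1,5,2,3,0,4] [Branch [4,1,0,5,2,3] [Branch [0,4,2,1,5,3] []]], Branch [5,0,2,1,3,4]
  [Branch [5,1,0,2,3,4] []]], Branch [4,1,0,5,2,3] [Branch [1,2,3,4,0,5] [Branch [1,4,5,0,2,3]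
  [], Branch [2,3,4,0,1,5] []], Branch [1,4,0,5,2,3] [Branch [5,1,0,4,2,3] [Branch
  [5,0,2,1,4,3] []]], Branch [4,0,2,1,3,5] [Branch [4,1,0,2,3,5] []]]], Branch [0,5] [Branch
  [1,4,3,5,0,2] [Branch [1,5,0,4,3,2] [Branch [1,5,4,3,0,2] []], Branch [0,4] [Branch
  [0,2,1,4,3,5] [Branch [1,2,5,4,3,0] []]], Branch [4,1,5,3,0,2] [Branch [1,5,0,4,3,2] []]],
  Branch [1,0,2,4,3,5] [Branch [1,4,3,0,2,5] [Branch [0,2,1,5,4,3] []], Branch [1,0,2,5,4,3]
  [], Branch [0,4,2,1,5,3] [Branch [0,2,1,5,4,3] []]], Branch [1,4,3,5,0,2] [Branch
  [4,1,3,5,0,2] [], Branch [1,0,2,4,3,5] [Branch [1,0,4,2,3,5] []], Branch [1,0,2,4,3,5]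
  [Branch [3,5,1,4,0,2] []]], Branch [1,4,3,0,2,5] [Branch [4,3,1,0,5,2] [Branch [4,3,5,1,0,2]
  [], Branch [4,3,1,0,2,5] []], Branch [4,3,1,0,5,2] [Branch [4,5,1,3,0,2] [Branch
  [1,5,4,2,3,0] []]], Branch [4,1,3,0,5,2] [Branch [4,3,1,0,5,2] []]], Branch [5,1,0,4,3,2]
  [Branch [1,2,5,0,4,3] [Branch [5,0,2,1,4,3] [Branch [0,2,4,5,3,1] []], Branch [1,5,4,2,3,0]
  []], Branch [5,4,3,1,0,2] [Branch [1,5,0,4,3,2] []], Branch [5,1,0,4,2,3] [Branch
  [1,2,5,0,4,3] []]]], Branch [0,5] [Branch [4,1,5,0,2,3] [Branch [1,5,2,4,0,3] [Branch
  [1,5,4,2,0,3] [], Branch [1,5,4,3,0,2] []], Branch [1,5,4,2,0,3] [Branch [3,1,5,0,4,2]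
  [Branch [0,5,3,4,2,1] []]], Branch [4,1,5,3,0,2] [Branch [1,5,4,3,0,2] []]], Branch
  [1,4,0,3,2,5] [Branch [4,1,0,3,2,5] [Branch [1,0,2,3,4,5] [Branch [1,0,3,2,4,5] []], Branch
  [4,3,1,2,5,0] []], Branch [4,1,0,3,2,5] [Branch [1,2,5,4,0,3] []], Branch [1,4,0,2,5,3]
  [Branch [4,3,1,2,5,0] []]], Branch [4,1,0,3,5,2] [Branch [1,4,3,5,0,2] [Branch [2,4,0,1,3,5]
  [Branch [2,0,3,4,5,1] []], Branch [1,4,2,0,3,5] []], Branch [1,4,3,5,0,2] [Branch
  [4,3,5,1,0,2] []], Branch [1,4,2,0,3,5] [Branch [3,1,5,0,4,2] []]], Branch [4,1,5,0,2,3]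
  [Branch [4,5,1,3,0,2] [Branch [4,5,3,1,0,2] [], Branch [4,5,1,0,2,3] []], Branch
  [4,5,1,3,0,2] [Branch [1,4,3,5,0,2] [Branch [1,0,3,2,4,5] []]], Branch [4,5,1,0,3,2] [Branch
  [4,1,5,3,0,2] []]]], Branch [0,5] [Branch [3,1,5,0,4,2] [Branch [1,5,3,2,0,4] [Branch
  [1,5,2,3,0,4] [], Branch [1,5,3,0,4,2] []], Branch [1,5,3,2,0,4] [Branch [3,1,2,5,0,4]
  [Branch [3,2,0,1,4,5] []]], Branch [3,1,5,0,2,4] [Branch [1,5,3,2,0,4] []]], Branch
  [1,3,0,4,2,5] [Branch [3,4,1,0,2,5] [Branch [1,0,2,4,3,5] [Branch [1,4,0,3,2,5] []], Branch
  [3,1,2,5,0,4] []], Branch [3,1,2,5,0,4] [Branch [1,2,5,3,0,4] []], Branch [1,3,0,2,5,4]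
  [Branch [3,4,1,0,2,5] []]], Branch [3,1,5,0,4,2] [Branch [3,5,1,2,0,4] [Branch [3,5,4,1,0,2]
  [], Branch [3,5,1,4,0,2] []], Branch [3,5,1,4,0,2] [Branch [2,3,5,0,1,4] [Branch
  [5,0,2,1,4,3] []]], Branch [3,5,1,2,0,4] [Branch [3,1,2,5,0,4] []]], Branch [1,3,0,4,2,5]
  [Branch [1,0,2,4,3,5] [Branch [4,1,5,0,2,3] [], Branch [4,1,5,0,2,3] []], Branch
  [3,1,4,5,0,2] [Branch [3,2,0,1,4,5] [Branch [3,2,0,4,1,5] []]], Branch [1,3,0,4,5,2] [Branch
  [4,5,1,0,3,2] []]]], Branch [0,4] [Branch [5,1,4,3,0,2] [Branch [1,4,0,5,2,3] [Branch
  [1,4,5,3,0,2] []], Branch [1,4,0,5,2,3] [Branch [5,1,3,4,0,2] []], Branch [1,5,4,2,3,0]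
  [Branch [5,1,3,4,0,2] []]], Branch [1,0,5,3,2,4] [Branch [1,5,3,0,2,4] [Branch [0,2,1,5,4,3]
  []], Branch [1,0,2,4,5,3] [], Branch [0,2,1,5,4,3] [Branch [1,0,5,2,4,3] []]], Branch
  [1,0,5,3,4,2] [Branch [1,5,3,4,0,2] [Branch [3,1,4,5,0,2] []], Branch [5,1,3,4,0,2] [],
  Branch [1,0,5,3,2,4] [Branch [3,1,4,5,0,2] []]], Branch [1,5,3,0,4,2] [Branch [5,4,3,1,0,2]
  [Branch [4,1,0,5,2,3] [Branch [4,1,2,0,5,3] []], Branch [4,1,2,0,5,3] [Branch [1,0,3,2,4,5]
  []]], Branch [5,3,1,0,4,2] [Branch [5,4,1,3,0,2] [Branch [1,5,4,2,3,0] []]], Branch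
  [1,5,3,2,0,4] [Branch [5,3,1,2,0,4] []]], Branch [4,1,0,5,2,3] [Branch [1,4,0,5,2,3] [Branch
  [2,4,0,5,1,3] [Branch [2,4,0,1,3,5] []], Branch [1,2,4,0,5,3] []], Branch [4,5,3,1,0,2]
  [Branch [1,4,0,5,2,3] []], Branch [4,1,0,5,3,2] [Branch [1,2,4,0,5,3] []]]], Branch [0,4]
  [Branch [5,1,4,0,3,2] [Branch [1,4,5,0,2,3] [Branch [1,4,2,5,0,3] [], Branch [1,4,5,3,0,2]
  []], Branch [1,4,5,0,2,3] [Branch [3,1,4,0,5,2] [Branch [1,4,2,0,3,5] []]], Branch
  [1,4,5,0,2,3] [Branch [5,1,4,2,0,3] []]], Branch [1,5,0,3,2,4] [Branch [5,1,0,2,4,3] [Branch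
  [1,0,3,5,2,4] [Branch [1,0,2,4,3,5] []], Branch [5,1,3,0,2,4] []], Branch [1,2,4,5,0,3]
  [Branch [5,1,0,2,4,3] []], Branch [5,0,2,1,4,3] [Branch [5,1,0,2,4,3] []]], Branch
  [1,5,0,3,2,4] [Branch [1,2,0,3,5,4] [Branch [3,4,1,0,2,5] [], Branch [3,4,1,0,2,5] []],
  Branch [5,1,0,3,4,2] [Branch [5,0,3,2,1,4] [Branch [2,5,0,3,4,1] []]], Branch [5,1,0,3,4,2]
  [Branch [1,2,5,0,3,4] []]], Branch [5,1,4,0,3,2] [Branch [5,4,1,3,0,2] [Branch [5,4,3,1,0,2]
  [], Branch [5,4,1,2,0,3] []], Branch [5,4,1,3,0,2] [Branch [5,4,0,2,1,3] [Branch
  [2,5,4,0,1,3] []]], Branch [5,1,4,2,0,3] [Branch [5,4,1,2,0,3] []]]], Branch [0,4] [Branch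
  [1,4,3,0,2,5] [Branch [3,1,2,4,0,5] [Branch [1,2,3,4,0,5] [], Branch [1,2,3,5,4,0] []],
  Branch [3,1,4,0,5,2] [Branch [1,4,2,3,0,5] []], Branch [1,4,3,5,0,2] [Branch [3,1,4,0,5,2]
  []]], Branch [1,3,0,2,4,5] [Branch [3,1,2,4,0,5] [Branch [1,0,5,3,2,4] [Branch [5,0,2,1,4,3]
  []], Branch [3,1,5,0,2,4] []], Branch [3,1,2,4,0,5] [Branch [1,2,4,3,0,5] []], Branch
  [3,1,5,0,2,4] [Branch [3,2,4,0,1,5] []]], Branch [3,4,1,0,2,5] [Branch [3,1,2,4,0,5] [Branch
  [3,4,2,0,1,5] [Branch [2,3,4,0,1,5] []], Branch [3,1,4,0,5,2] []], Branch [3,1,4,0,5,2]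
  [Branch [3,4,5,1,0,2] []], Branch [3,1,4,0,5,2] [Branch [3,4,1,0,5,2] []]], Branch
  [1,3,0,5,4,2] [Branch [1,0,5,3,4,2] [Branch [3,5,1,4,0,2] [Branch [1,2,0,5,3,4] []], Branch
  [1,0,5,3,2,4] []], Branch [3,5,1,4,0,2] [Branch [3,2,0,1,5,4] [Branch [2,3,0,5,4,1] []]],
  Branch [1,0,5,3,2,4] [Branch [1,3,2,0,5,4] []]]]])"
    by code_simp
qed simp

section \<open>Systems without good sequencings\<close>

text \<open>
  A family of sets of natural numbers below some bound, stored as a binary tree:
  \<open>Node F G\<close> branches on whether \<open>0\<close> is an element, and the remaining elements are shifted down.
\<close>

datatype family = Empty | Unit | Node family family

primrec member :: "(nat \<Rightarrow> bool) \<Rightarrow> family \<Rightarrow> bool" where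
  "member s Empty \<longleftrightarrow> False"
| "member s Unit \<longleftrightarrow> True"
| "member s (Node F G) \<longleftrightarrow>
     (if s 0 then member (\<lambda>i. s (Suc i)) G else member (\<lambda>i. s (Suc i)) F)"

text \<open>Collapsing childless nodes makes emptiness visible as the constructor
  \<open>Empty\<close>, which is what the final computations test.\<close>

fun node :: "family \<Rightarrow> family \<Rightarrow> family" where
  "node Empty Empty = Empty"
| "node F G = Node F G"

lemma member_node [simp]: "member s (node F G) \<longleftrightarrow> member s (Node F G)"
  by (cases "(F, G)" rule: node.cases) auto

fun union :: "family \<Rightarrow> family \<Rightarrow> family" where
  "union Empty G = G"
| "union F Empty = F"
| "union (Node F F') (Node G G') = Node (union F G) (union F' G')"
| "union F G = Unit"

text \<open>The only subset of \<open>{..<n}\<close> in this family is the empty set, the point set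
  of the empty initial segment.\<close>

primrec singleton :: "nat \<Rightarrow> family" where
  "singleton 0 = Unit"
| "singleton (Suc n) = Node (singleton n) Empty"

fun restrict :: "bool \<Rightarrow> nat \<Rightarrow> family \<Rightarrow> family" where
  "restrict True 0 (Node F G) = node Empty G"
| "restrict False 0 (Node F G) = node F Empty"
| "restrict b (Suc x) (Node F G) = node (restrict b x F) (restrict b x G)"
| "restrict b x F = F"

text \<open>Keeps the members that contain \<open>z\<close> whenever they contain \<open>x\<close>.
  At the smaller of the two points one half satisfies the implication outright, and the other half
  is restricted at the remaining point.\<close>

fun impose :: "nat \<Rightarrow> nat \<Rightarrow> family \<Rightarrow> family" where
  "impose 0 (Suc z) (Node F G) = node F (restrict True z G)"
| "impose (Suc x) 0 (Node F G) = node (restrict False x F) G"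
| "impose (Suc x) (Suc z) (Node F G) = node (impose x z F) (impose x z G)"
| "impose x z F = F"

text \<open>Members already containing \<open>y\<close> are dropped, since an appended point must be
  new.\<close>

fun add :: "nat \<Rightarrow> family \<Rightarrow> family" where
  "add 0 (Node F G) = node Empty F"
| "add (Suc y) (Node F G) = node (add y F) (add y G)"
| "add y F = F"

text \<open>One inclusion suffices here and in the next lemmas: a family may be too large, because
  only its emptiness is used. This also justifies the default value \<open>Unit\<close> in
  \<open>union\<close>.\<close>

lemma member_union: "member s F \<or> member s G \<Longrightarrow> member s (union F G)"
  by (induction F G arbitrary: s rule: union.induct) (auto split: if_splits)

lemma member_singleton: "member (\<lambda>i. False) (singleton n)"
  by (induction n) auto

lemma member_restrict: "member s F \<Longrightarrow> s x = b \<Longrightarrow> member s (restrict b x F)"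
  by (induction b x F arbitrary: s rule: restrict.induct) (auto split: if_splits)

lemma member_impose: "member s F \<Longrightarrow> (s x \<longrightarrow> s z) \<Longrightarrow> member s (impose x z F)"
  by (induction x z F arbitrary: s rule: impose.induct)
    (auto split: if_splits intro: member_restrict)

lemma member_add: "member s F \<Longrightarrow> \<not> s y \<Longrightarrow> member (\<lambda>i. i = y \<or> s i) (add y F)"
  by (induction y F arbitrary: s rule: add.induct) (auto split: if_splits)

text \<open>
  A point \<open>y\<close> can be appended to an initial segment with point set \<open>S\<close> unless some triple
  \<open>(x, y, z)\<close> has \<open>x\<close> inside and \<open>z\<close> outside of \<open>S\<close>. The recursions avoid abstractions and
  partially evaluated conditionals, which would make \<open>code_simp\<close> unfold them symbolically.
\<close>

fun impose_if :: "bool \<Rightarrow> nat \<Rightarrow> nat \<Rightarrow> family \<Rightarrow> family" where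
  "impose_if True x z F = impose x z F"
| "impose_if False x z F = F"

fun extend_layer :: "(nat \<times> nat \<times> nat) list \<Rightarrow> nat \<Rightarrow> family \<Rightarrow> family" where
  "extend_layer [] y F = add y F"
| "extend_layer ((x, m, z) # L) y F = extend_layer L y (impose_if (m = y) x z F)"

primrec next_layer :: "nat \<Rightarrow> (nat \<times> nat \<times> nat) list \<Rightarrow> family \<Rightarrow> family" where
  "next_layer 0 L F = Empty"
| "next_layer (Suc y) L F = union (extend_layer L y F) (next_layer y L F)"

text \<open>A breadth-first search over point sets, graded by size, in place of a search over
  permutations.\<close>

primrec layer :: "nat \<Rightarrow> (nat \<times> nat \<times> nat) list \<Rightarrow> nat \<Rightarrow> family" where
  "layer v L 0 = singleton v"
| "layer v L (Suc k) = next_layer v L (layer v L k)"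

lemma member_extend_layer:
  "member s F \<Longrightarrow> \<not> s y \<Longrightarrow> \<forall>x z. (x, y, z) \<in> set L \<and> s x \<longrightarrow> s z \<Longrightarrow>
    member (\<lambda>i. i = y \<or> s i) (extend_layer L y F)"
proof (induction L y F rule: extend_layer.induct)
  case (2 x m z L y F)
  have "s x \<longrightarrow> s z" if "m = y"
    using 2(4) that by auto
  then have "member s (impose_if (m = y) x z F)"
    using 2(2) by (cases "m = y") (simp_all add: member_impose)
  moreover have "\<forall>x z. (x, y, z) \<in> set L \<and> s x \<longrightarrow> s z"
    using 2(4) by (meson list.set_intros(2))
  ultimately show ?case
    unfolding extend_layer.simps using 2(1,3) by blast
qed (simp add: member_add)

lemma member_next_layer:
  "member s (extend_layer L y F) \<Longrightarrow> y < v \<Longrightarrow> member s (next_layer v L F)"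
  by (induction v) (auto simp: less_Suc_eq intro: member_union)

section \<open>Checking explicit systems and completeness of the layers\<close>

fun valid_triples :: "nat \<Rightarrow> (nat \<times> nat \<times> nat) list \<Rightarrow> bool" where
  "valid_triples v [] \<longleftrightarrow> True"
| "valid_triples v ((x, y, z) # L) \<longleftrightarrow>
     x < v \<and> y < v \<and> z < v \<and> x \<noteq> y \<and> x \<noteq> z \<and> y \<noteq> z \<and> valid_triples v L"

fun successors :: "nat \<Rightarrow> (nat \<times> nat \<times> nat) list \<Rightarrow> nat list" where
  "successors a [] = []"
| "successors a ((x, y, z) # L) =
     (if a = x then y # z # successors a L else if a = y then z # successors a L
      else successors a L)"

primrec check_row :: "nat \<Rightarrow> nat list \<Rightarrow> nat \<Rightarrow> bool" where
  "check_row a xs 0 \<longleftrightarrow> True"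
| "check_row a xs (Suc b) \<longleftrightarrow> (a = b \<or> count_list xs b = 1) \<and> check_row a xs b"

primrec check_rows :: "nat \<Rightarrow> (nat \<times> nat \<times> nat) list \<Rightarrow> nat \<Rightarrow> bool" where
  "check_rows v L 0 \<longleftrightarrow> True"
| "check_rows v L (Suc a) \<longleftrightarrow> check_row a (successors a L) v \<and> check_rows v L a"

lemma valid_triplesD:
  "valid_triples v L \<Longrightarrow> (x, y, z) \<in> set L \<Longrightarrow>
    x < v \<and> y < v \<and> z < v \<and> x \<noteq> y \<and> x \<noteq> z \<and> y \<noteq> z"
  by (induction v L rule: valid_triples.induct) auto

lemma check_rowD: "check_row a xs v \<Longrightarrow> b < v \<Longrightarrow> a = b \<or> count_list xs b = 1"
  by (induction v) (auto simp: less_Suc_eq)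

lemma check_rowsD: "check_rows v L w \<Longrightarrow> a < w \<Longrightarrow> check_row a (successors a L) v"
  by (induction w) (auto simp: less_Suc_eq)

text \<open>With distinct entries a triple contributes a given edge at most once, so counting
  occurrences of \<open>b\<close> counts triples.\<close>

lemma count_successors:
  "valid_triples v L \<Longrightarrow>
    count_list (successors a L) b = length (filter (\<lambda>t. (a, b) \<in> triple_edges t) L)"
  by (induction v L rule: valid_triples.induct) (auto simp: triple_edges_def)

text \<open>Along a good sequencing each appended point passes the test of
  \<open>extend_layer\<close>: if \<open>z\<close> were outside the segment it would come later, and
  the triple would occur in order.\<close>

lemma layer_complete:
  assumes good: "good_sequencing {..<v} (set L) xs"
    and D: "directed_triple_system v {..<v} (set L)" and "k \<le> v"
  shows "member (\<lambda>p. p \<in> set (take k xs)) (layer v L k)"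
  using \<open>k \<le> v\<close>
proof (induction k)
  case (Suc k)
  let ?S = "set (take k xs)" and ?y = "xs ! k"
  have xs: "set xs = {..<v}" "distinct xs"
    using good by (auto simp: good_sequencing_iff)
  then have len: "length xs = v"
    using distinct_card by fastforce
  then have "?y < v"
    using xs Suc.prems nth_mem[of k xs] by auto
  have y: "?y \<notin> ?S"
    using xs(2) len Suc.prems by (auto simp: in_set_conv_nth nth_eq_iff_index_eq)
  have "z \<in> ?S" if "(x, ?y, z) \<in> set L" "x \<in> ?S" for x z
  proof (rule ccontr)
    assume "z \<notin> ?S"
    have "transitive_triple (x, ?y, z) \<and> (x, ?y, z) \<in> {..<v} \<times> {..<v} \<times> {..<v}"
      using D that(1) unfolding directed_triple_system_def by blast
    then have "z \<in> set xs" "z \<noteq> ?y"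
      using xs by (auto simp: transitive_triple_def)
    then obtain m where m: "m < length xs" "z = xs ! m" "m \<noteq> k"
      by (auto simp: in_set_conv_nth)
    have "\<not> m < k"
      using \<open>z \<notin> ?S\<close> m len Suc.prems by (auto simp: in_set_conv_nth)
    then have "k < m"
      using m by simp
    moreover obtain i where "i < k" "x = xs ! i"
      using \<open>x \<in> ?S\<close> by (auto simp: in_set_conv_nth)
    ultimately have "subseq [x, ?y, z] xs"
      unfolding subseq_triple_iff using m by blast
    then show False
      using good that(1) unfolding good_sequencing_iff by blast
  qed
  then have "member (\<lambda>p. p = ?y \<or> p \<in> ?S) (extend_layer L ?y (layer v L k))"
    using y Suc by (intro member_extend_layer) auto
  moreover have "set (take (Suc k) xs) = insert ?y ?S"
    using len Suc.prems by (simp add: take_Suc_conv_app_nth)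
  then have "(\<lambda>p. p \<in> set (take (Suc k) xs)) = (\<lambda>p. p = ?y \<or> p \<in> ?S)"
    by simp
  ultimately show ?case
    using \<open>?y < v\<close> by (simp add: member_next_layer)
qed (simp add: member_singleton)

lemma directed_triple_system_if_check:
  assumes valid: "valid_triples v L" and rows: "check_rows v L v"
  shows "directed_triple_system v {..<v} (set L)"
proof -
  have "\<exists>!t. t \<in> set L \<and> (a, b) \<in> triple_edges t" if "a < v" "b < v" "a \<noteq> b" for a b
  proof -
    have "length (filter (\<lambda>t. (a, b) \<in> triple_edges t) L) = 1"
      using check_rowD[OF check_rowsD[OF rows]] count_successors[OF valid] that by metis
    then obtain t where "filter (\<lambda>t. (a, b) \<in> triple_edges t) L = [t]"
      by (auto simp: length_Suc_conv)
    then have "{s \<in> set L. (a, b) \<in> triple_edges s} = {t}"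
      by (metis list.set(1,2) set_filter)
    then have "s \<in> set L \<and> (a, b) \<in> triple_edges s \<longleftrightarrow> s = t" for s
      by blast
    then show ?thesis
      by simp
  qed
  moreover have "transitive_triple t \<and> t \<in> {..<v} \<times> {..<v} \<times> {..<v}" if "t \<in> set L" for t
    using valid_triplesD[OF valid] that by (cases t) (auto simp: transitive_triple_def)
  ultimately show ?thesis
    by (simp add: directed_triple_system_def)
qed

section \<open>Explicit systems without good sequencings\<close>

definition nonsequenceable :: "nat \<Rightarrow> (nat \<times> nat \<times> nat) set \<Rightarrow> bool" where
  "nonsequenceable v B \<longleftrightarrow>
     directed_triple_system v {..<v} B \<and> (\<nexists>xs. good_sequencing {..<v} B xs)"

text \<open>The first \<open>k\<close> points of a good sequencing would form a member of the
  layer.\<close>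

lemma nonsequenceable_if_layer_empty:
  assumes "valid_triples v L" "check_rows v L v" "layer v L k = Empty" "k \<le> v"
  shows "nonsequenceable v (set L)"
  using layer_complete[of v L _ k] directed_triple_system_if_check[of v L] assms
  by (auto simp: nonsequenceable_def)

lemma nonsequenceable_extension:
  assumes "nonsequenceable v A" "directed_triple_system w {..<w} B" "A \<subseteq> B" "v \<le> w"
  shows "nonsequenceable w B"
  using assms good_sequencing_restrict[of "{..<w}" B _ "{..<v}" A]
  by (fastforce simp: nonsequenceable_def)

text \<open>
  The systems of orders 7 to 13 below were found by simulated annealing on the number of reachable
  point sets. No initial segment of the length given to \<open>layer\<close> survives.
\<close>

definition system_7 :: "(nat \<times> nat \<times> nat) list" where
  "system_7 =
    [(0,2,4), (0,6,1), (1,3,0), (1,4,2), (2,0,3), (2,5,1), (3,1,5), (3,6,2), (4,1,6), (4,5,0),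
     (5,2,6), (5,4,3), (6,0,5), (6,3,4)]"

lemma nonsequenceable_7: "nonsequenceable 7 (set system_7)"
proof (rule nonsequenceable_if_layer_empty)
  show "valid_triples 7 system_7" "check_rows 7 system_7 7"
    by code_simp+
  show "layer 7 system_7 5 = Empty"
    by code_simp
qed simp

lemma nonsequenceable_9: "\<exists>B. nonsequenceable 9 B"
proof -
  let ?L =
    "[(0,3,6), (0,5,2), (0,8,4), (1,4,3), (1,7,5), (2,5,6), (2,7,4), (2,8,0), (3,0,7), (3,2,1),
     (3,5,8), (4,1,0), (4,6,5), (4,7,2), (5,0,1), (5,3,4), (6,1,2), (6,4,8), (6,7,3), (7,1,8),
     (7,6,0), (8,1,6), (8,2,3), (8,5,7)]"
  have "valid_triples 9 ?L" "check_rows 9 ?L 9"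
    by code_simp+
  moreover have "layer 9 ?L 8 = Empty"
    by code_simp
  ultimately show ?thesis
    using nonsequenceable_if_layer_empty by fastforce
qed

lemma nonsequenceable_10: "\<exists>B. nonsequenceable 10 B"
proof -
  let ?L =
    "[(0,1,7), (0,2,6), (0,3,8), (1,0,4), (1,2,5), (1,9,8), (2,0,9), (2,4,3), (2,7,8), (3,1,6),
     (3,5,9), (3,7,4), (4,6,0), (4,7,5), (4,8,1), (5,3,2), (5,6,1), (5,8,4), (6,4,9), (6,5,7),
     (6,8,3), (7,2,1), (7,3,0), (7,9,6), (8,5,0), (8,6,2), (8,9,7), (9,0,5), (9,1,3), (9,4,2)]"
  have "valid_triples 10 ?L" "check_rows 10 ?L 10"
    by code_simp+
  moreover have "layer 10 ?L 8 = Empty"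
    by code_simp
  ultimately show ?thesis
    using nonsequenceable_if_layer_empty by fastforce
qed

lemma nonsequenceable_12: "\<exists>B. nonsequenceable 12 B"
proof -
  let ?L =
    "[(0,1,6), (0,2,9), (0,10,3), (0,11,7), (1,0,8), (1,2,10), (1,3,5), (1,11,4), (2,1,7),
     (2,3,4), (2,6,8), (3,1,9), (3,2,0), (3,10,7), (3,11,8), (4,7,1), (4,8,9), (4,10,0),
     (4,11,2), (5,0,4), (5,6,7), (5,8,10), (5,9,11), (6,2,11), (6,5,3), (6,9,1), (7,4,5),
     (7,6,10), (7,8,11), (7,9,3), (8,4,3), (8,5,1), (8,6,0), (8,7,2), (9,5,2), (9,6,4), (9,7,0),
     (9,10,8), (10,2,5), (10,4,6), (10,11,1), (11,0,5), (11,3,6), (11,10,9)]"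
  have "valid_triples 12 ?L" "check_rows 12 ?L 12"
    by code_simp+
  moreover have "layer 12 ?L 9 = Empty"
    by code_simp
  ultimately show ?thesis
    using nonsequenceable_if_layer_empty by fastforce
qed

lemma nonsequenceable_13: "\<exists>B. nonsequenceable 13 B"
proof -
  let ?L =
    "[(0,1,2), (0,3,11), (0,7,5), (0,8,12), (0,9,6), (1,0,10), (1,4,6), (1,7,9), (1,8,3),
     (2,1,12), (2,7,10), (2,8,0), (2,11,3), (3,5,4), (3,6,1), (3,7,8), (3,10,2), (4,5,2),
     (4,9,11), (4,10,3), (4,12,8), (5,3,0), (5,8,7), (5,10,1), (5,11,12), (6,3,9), (6,8,5),
     (6,11,7), (6,12,10), (7,0,4), (7,1,11), (7,2,6), (7,3,12), (8,2,9), (8,6,4), (8,11,10),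
     (9,2,5), (9,4,1), (9,10,8), (9,12,3), (10,4,0), (10,5,6), (10,9,7), (10,12,11), (11,2,4),
     (11,5,9), (11,6,0), (11,8,1), (12,1,5), (12,4,7), (12,6,2), (12,9,0)]"
  have "valid_triples 13 ?L" "check_rows 13 ?L 13"
    by code_simp+
  moreover have "layer 13 ?L 10 = Empty"
    by code_simp
  ultimately show ?thesis
    using nonsequenceable_if_layer_empty by fastforce
qed

text \<open>
  Doubling does not reach order \<open>16 = 2 * 6 + 4\<close>, since order 6 is always sequenceable.
\<close>

lemma nonsequenceable_16: "\<exists>B. nonsequenceable 16 B"
proof -
  let ?L =
    "[(0,10,15), (0,11,13), (1,7,8), (1,10,9), (1,12,15), (1,13,11), (2,7,10), (2,8,12), (3,7,12),
     (3,8,10), (3,14,9), (4,9,7), (4,13,12), (5,9,8), (5,12,10), (5,14,13), (6,8,13), (6,11,12),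
     (6,14,15), (7,0,14), (7,2,11), (7,3,13), (7,4,15), (7,6,9), (8,2,15), (8,4,11), (8,7,1),
     (8,9,6), (8,14,0), (9,4,10), (9,5,15), (9,12,11), (9,13,0), (9,14,3), (10,0,12), (10,2,13),
     (10,8,5), (10,11,4), (10,14,1), (11,0,8), (11,1,14), (11,3,15), (11,6,10), (11,7,5),
     (11,9,2), (12,0,9), (12,5,7), (12,8,3), (12,13,1), (12,14,6), (13,2,9), (13,4,14), (13,6,7),
     (13,10,3), (13,15,5), (14,4,8), (14,5,11), (14,10,7), (14,12,2), (15,0,7), (15,2,14),
     (15,3,11), (15,9,1), (15,10,6), (15,12,4), (15,13,8)]"
  \<comment> \<open>The points below 7 carry \<open>system_7\<close>, and \<open>?L\<close> covers
    exactly the edges with an end outside them.\<close>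
  have "valid_triples 16 (system_7 @ ?L)" "check_rows 16 (system_7 @ ?L) 16"
    by code_simp+
  then have "directed_triple_system 16 {..<16} (set (system_7 @ ?L))"
    by (rule directed_triple_system_if_check)
  then have "nonsequenceable 16 (set (system_7 @ ?L))"
    by (rule nonsequenceable_extension[OF nonsequenceable_7]) auto
  then show ?thesis ..
qed

section \<open>Extending a system\<close>

text \<open>An exact partition of the edges of an arbitrary digraph into transitive triples. Triple
  systems are the case of a complete digraph; the general form allows gluing edge-disjoint
  pieces.\<close>

definition decomposes :: "('a \<times> 'a \<times> 'a) set \<Rightarrow> ('a \<times> 'a) set \<Rightarrow> bool" where
  "decomposes B E \<longleftrightarrow>
     (\<forall>t\<in>B. transitive_triple t \<and> triple_edges t \<subseteq> E) \<and>
     (\<forall>e\<in>E. \<exists>!t. t \<in> B \<and> e \<in> triple_edges t)"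

lemma decomposes_Un:
  assumes "decomposes A E" "decomposes B F" "E \<inter> F = {}"
  shows "decomposes (A \<union> B) (E \<union> F)"
proof -
  have edges: "transitive_triple t \<and> triple_edges t \<subseteq> E \<union> F" if "t \<in> A \<union> B" for t
    using assms that unfolding decomposes_def by blast
  have "\<exists>!t. t \<in> A \<union> B \<and> e \<in> triple_edges t" if "e \<in> E \<union> F" for e
  proof (cases "e \<in> E")
    case True
    then have "t \<in> A \<union> B \<and> e \<in> triple_edges t \<longleftrightarrow> t \<in> A \<and> e \<in> triple_edges t" for t
      using assms unfolding decomposes_def by blast
    then show ?thesis
      using assms(1) True unfolding decomposes_def by simp
  next
    case False
    then have "t \<in> A \<union> B \<and> e \<in> triple_edges t \<longleftrightarrow> t \<in> B \<and> e \<in> triple_edges t" for t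
      using assms unfolding decomposes_def by blast
    then show ?thesis
      using assms(2) False that unfolding decomposes_def by simp
  qed
  with edges show ?thesis
    unfolding decomposes_def by simp
qed

lemma directed_triple_system_iff_decomposes:
  "directed_triple_system v X B \<longleftrightarrow>
     finite X \<and> card X = v \<and> decomposes B {(a, b). a \<in> X \<and> b \<in> X \<and> a \<noteq> b}"
proof -
  have "transitive_triple t \<and> t \<in> X \<times> X \<times> X \<longleftrightarrow>
      transitive_triple t \<and> triple_edges t \<subseteq> {(a, b). a \<in> X \<and> b \<in> X \<and> a \<noteq> b}"
    for t :: "'a \<times> 'a \<times> 'a"
    by (cases t) (auto simp: transitive_triple_def triple_edges_def)
  moreover have "(\<forall>a b. a \<in> X \<and> b \<in> X \<and> a \<noteq> b \<longrightarrow> P a b) \<longleftrightarrow>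
      (\<forall>a\<in>X. \<forall>b\<in>X. a \<noteq> b \<longrightarrow> P a b)" for P
    by blast
  ultimately show ?thesis
    unfolding directed_triple_system_def decomposes_def by simp
qed

section \<open>Translations and differences modulo \<open>n\<close>\<close>

lemma shift_inj:
  fixes i j n d :: nat
  assumes "(i + d) mod n = (j + d) mod n" "i < n" "j < n"
  shows "i = j"
proof -
  have "[i + d = j + d] (mod n)"
    using assms(1) by (simp add: cong_def)
  then have "[i = j] (mod n)"
    by (simp only: cong_add_rcancel_nat)
  then show ?thesis
    using assms by (simp add: cong_def)
qed

lemma shift_surj:
  fixes j n d :: nat
  assumes "j < n"
  obtains i where "i < n" "(i + d) mod n = j"
proof
  \<comment> \<open>The witness is \<open>j - d\<close> modulo \<open>n\<close>, written so that
    subtraction does not truncate.\<close>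
  show "(j + (n - d mod n)) mod n < n"
    using assms by simp
  have "((j + (n - d mod n)) mod n + d) mod n = (j + (n - d mod n) + d mod n) mod n"
    by (simp add: mod_simps)
  also have "j + (n - d mod n) + d mod n = j + n"
  proof -
    have "d mod n \<le> n"
      using assms by (simp add: less_imp_le)
    then show ?thesis
      by simp
  qed
  also have "(j + n) mod n = j"
    using assms by simp
  finally show "((j + (n - d mod n)) mod n + d) mod n = j" .
qed

text \<open>
  The points \<open>v, \<dots>, v + n - 1\<close> are a copy of the integers modulo \<open>n\<close>. The edges of difference
  at least \<open>c\<close> between them form \<open>n - c\<close> permutations without fixed points, and the old point
  \<open>x\<close> is placed in the middle of all edges of difference \<open>x + c\<close>.
\<close>

lemma decomposes_join:
  fixes v c n :: nat
  assumes "n = v + c" "0 < c"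
  defines "Y \<equiv> {v..<v + n}"
  shows "decomposes {(v + i, x, v + (i + (x + c)) mod n) |i x. i < n \<and> x < v}
    ({..<v} \<times> Y \<union> Y \<times> {..<v} \<union> {(v + i, v + (i + d) mod n) |i d. i < n \<and> c \<le> d \<and> d < n})"
    (is "decomposes ?B ?E")
  unfolding decomposes_def
proof (intro conjI ballI)
  fix t assume "t \<in> ?B"
  then obtain i x where t: "t = (v + i, x, v + (i + (x + c)) mod n)" "i < n" "x < v"
    by blast
  \<comment> \<open>The difference satisfies \<open>0 < x + c\<close> and \<open>x + c < n\<close>,
    so it is nonzero modulo \<open>n\<close>.\<close>
  have "(i + (x + c)) mod n \<noteq> i"
    using shift_inj[of "x + c" i n 0] t assms by (auto simp: add.commute)
  then show "transitive_triple t"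
    using t by (auto simp: transitive_triple_def)
  have "(v + i, v + (i + (x + c)) mod n) \<in> ?E"
    using t assms(1) by force
  then show "triple_edges t \<subseteq> ?E"
    using t assms(1) by (auto simp: triple_edges_def Y_def)
next
  fix e assume "e \<in> ?E"
  then consider (out) x j where "e = (x, v + j)" "x < v" "j < n"
    | (into) x j where "e = (v + j, x)" "x < v" "j < n"
    | (inner) i d where "e = (v + i, v + (i + d) mod n)" "i < n" "c \<le> d" "d < n"
    unfolding Y_def by (auto simp: le_iff_add)
  then show "\<exists>!t. t \<in> ?B \<and> e \<in> triple_edges t"
  proof cases
    case out
    \<comment> \<open>The covering triple starts at \<open>j\<close> shifted back by the difference
      that belongs to \<open>x\<close>.\<close>
    obtain i where i: "i < n" "(i + (x + c)) mod n = j"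
      using shift_surj[OF out(3)] .
    show ?thesis
    proof (rule ex1I)
      show "(v + i, x, v + (i + (x + c)) mod n) \<in> ?B \<and>
          e \<in> triple_edges (v + i, x, v + (i + (x + c)) mod n)"
        using out i by (auto simp: triple_edges_def)
      fix t assume t: "t \<in> ?B \<and> e \<in> triple_edges t"
      then obtain i' x' where t': "t = (v + i', x', v + (i' + (x' + c)) mod n)" "i' < n" "x' < v"
        by blast
      then have "x' = x" "(i' + (x' + c)) mod n = j"
        using t out by (auto simp: triple_edges_def)
      then show "t = (v + i, x, v + (i + (x + c)) mod n)"
        using t' i shift_inj by metis
    qed
  next
    case into
    then show ?thesis
      by (intro ex1I[of _ "(v + j, x, v + (j + (x + c)) mod n)"]) (auto simp: triple_edges_def)
  next
    case inner
    show ?thesis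
    proof (rule ex1I)
      \<comment> \<open>The difference determines the middle point, and \<open>d < v + c\<close>
        makes \<open>d - c\<close> an old point.\<close>
      show "(v + i, d - c, v + (i + d) mod n) \<in> ?B \<and>
          e \<in> triple_edges (v + i, d - c, v + (i + d) mod n)"
        using inner assms(1) by (force simp: triple_edges_def)
      fix t assume t: "t \<in> ?B \<and> e \<in> triple_edges t"
      then obtain i' x' where t': "t = (v + i', x', v + (i' + (x' + c)) mod n)" "i' < n" "x' < v"
        by blast
      then have "i' = i" "(i + (x' + c)) mod n = (i + d) mod n"
        using t inner by (auto simp: triple_edges_def)
      moreover from this have "x' + c = d"
        using shift_inj[of "x' + c" i n d] t' inner assms(1) by (simp add: add.commute)
      ultimately show "t = (v + i, d - c, v + (i + d) mod n)"
        using t' by auto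
    qed
  qed
qed

text \<open>The base triple \<open>(0, 1, 3)\<close> has the differences 1, 3 and 2, once each, so
  its translates cover every edge with one of these differences exactly once.\<close>

lemma decomposes_small_differences:
  fixes v n :: nat
  assumes "7 \<le> n"
  shows "decomposes {(v + i, v + (i + 1) mod n, v + (i + 3) mod n) |i. i < n}
    {(v + i, v + (i + d) mod n) |i d. i < n \<and> 1 \<le> d \<and> d < 4}"
    (is "decomposes ?B ?E")
proof -
  have shift: "((i + a) mod n + b) mod n = (i + (a + b)) mod n" for i a b
    by (simp add: mod_simps add.assoc)
  have diff: "a = b" if "(i + a) mod n = (i + b) mod n" "a < n" "b < n" for i a b
    using shift_inj[of a i n b] that by (simp add: add.commute)
  show ?thesis
    unfolding decomposes_def
  proof (intro conjI ballI)
    fix t assume "t \<in> ?B"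
    then obtain i where t: "t = (v + i, v + (i + 1) mod n, v + (i + 3) mod n)" "i < n"
      by blast
    then show "transitive_triple t"
      using diff[of i 0 1] diff[of i 0 3] diff[of i 1 3] assms
      by (auto simp: transitive_triple_def)
    have "(v + i, v + (i + 1) mod n) \<in> ?E" "(v + i, v + (i + 3) mod n) \<in> ?E"
      using t(2) by force+
    moreover have "((i + 1) mod n + 2) mod n = (i + 3) mod n"
      unfolding shift by (simp add: numeral_3_eq_3)
    then have "(v + (i + 1) mod n, v + (i + 3) mod n) \<in> ?E"
      using assms by (intro CollectI exI[of _ "(i + 1) mod n"] exI[of _ 2]) simp
    ultimately show "triple_edges t \<subseteq> ?E"
      by (simp only: t(1) triple_edges_def prod.case insert_subset empty_subsetI simp_thms)
  next
    fix e assume "e \<in> ?E"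
    then obtain i d where e: "e = (v + i, v + (i + d) mod n)" "i < n" "1 \<le> d" "d < 4"
      by blast
    have edges: "e \<in> triple_edges (v + k, v + (k + 1) mod n, v + (k + 3) mod n) \<longleftrightarrow>
        (d \<noteq> 2 \<and> k = i) \<or> (d = 2 \<and> (k + 1) mod n = i)" if "k < n" for k
    proof -
      have "((k + 1) mod n + d) mod n = (k + 3) mod n \<longleftrightarrow> d = 2"
        using shift[of k 1 d] diff[of k "1 + d" 3] e assms by (auto simp: numeral_3_eq_3)
      moreover have "(i + d) mod n = (i + 1) mod n \<longleftrightarrow> d = 1"
        "(i + d) mod n = (i + 3) mod n \<longleftrightarrow> d = 3"
        using diff[of i d 1] diff[of i d 3] e assms by auto
      ultimately show ?thesis
        using e by (auto simp: triple_edges_def)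
    qed
    obtain j where j: "j < n" "(j + 1) mod n = i"
      using shift_surj[OF e(2)] .
    \<comment> \<open>Edges of difference 1 and 3 leave the first point of their triple. Those of
      difference 2 leave its second point, hence one step back.\<close>
    define k where "k = (if d = 2 then j else i)"
    have "k < n"
      using j(1) e(2) by (simp add: k_def)
    moreover have "e \<in> triple_edges (v + k', v + (k' + 1) mod n, v + (k' + 3) mod n) \<longleftrightarrow> k' = k"
      if "k' < n" for k'
    proof (cases "d = 2")
      case True
      have "(k' + 1) mod n = i \<longleftrightarrow> k' = j"
        using j shift_inj that by metis
      then show ?thesis
        using edges[OF that] True by (simp only: k_def simp_thms if_True)
    next
      case False
      then show ?thesis
        using edges[OF that] by (simp only: k_def simp_thms if_False)
    qed
    ultimately show "\<exists>!t. t \<in> ?B \<and> e \<in> triple_edges t"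
      by (intro ex1I[of _ "(v + k, v + (k + 1) mod n, v + (k + 3) mod n)"]) blast+
  qed
qed

text \<open>The complete digraph splits into the old edges, the join with the large differences, and
  the small differences. The old system stays a subsystem and so obstructs good sequencings.\<close>

lemma nonsequenceable_double:
  assumes A: "nonsequenceable v A" and c: "c = 1 \<or> c = 4 \<and> 3 \<le> v"
  shows "\<exists>B. nonsequenceable (2 * v + c) B"
proof -
  let ?n = "v + c"
  let ?Y = "{v..<v + ?n}"
  let ?old = "{(a, b). a \<in> {..<v} \<and> b \<in> {..<v} \<and> a \<noteq> b}"
  let ?large = "{(v + i, v + (i + d) mod ?n) |i d. i < ?n \<and> c \<le> d \<and> d < ?n}"
  let ?small = "{(v + i, v + (i + d) mod ?n) |i d. i < ?n \<and> 1 \<le> d \<and> d < c}"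
  let ?join = "{..<v} \<times> ?Y \<union> ?Y \<times> {..<v} \<union> ?large"
  \<comment> \<open>For \<open>c = 1\<close> there are no small differences. For
    \<open>c = 4\<close> they are 1, 2 and 3, and \<open>v\<close> being at least 3 makes the
    modulus at least 7.\<close>
  obtain C where C: "decomposes C ?small"
  proof (cases "c = 1")
    case True
    then have "decomposes {} ?small"
      by (auto simp: decomposes_def)
    then show ?thesis ..
  next
    case False
    then show ?thesis
      using that c decomposes_small_differences[of ?n v] by auto
  qed
  have diff: "a = b" if "(i + a) mod ?n = (i + b) mod ?n" "a < ?n" "b < ?n" for i a b
    using shift_inj[of a i ?n b] that by (simp add: add.commute)
  obtain J where J: "decomposes J ?join"
    using decomposes_join[of ?n v c] c by auto
  \<comment> \<open>Between new points the difference is unique modulo \<open>?n\<close>: at least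
    \<open>c\<close> in the join, below \<open>c\<close> here.\<close>
  have "e \<notin> ?join" if small: "e \<in> ?small" for e
  proof
    assume "e \<in> ?join"
    obtain i d where e: "e = (v + i, v + (i + d) mod ?n)" "i < ?n" "d < c"
      using small by blast
    with \<open>e \<in> ?join\<close> have "e \<in> ?large"
      by auto
    then obtain d' where "(i + d) mod ?n = (i + d') mod ?n" "c \<le> d'" "d' < ?n"
      using e by auto
    then show False
      using diff[of i d d'] e by simp
  qed
  then have "?join \<inter> ?small = {}"
    by blast
  moreover have "?old \<inter> (?join \<union> ?small) = {}"
    by auto
  ultimately have "decomposes (A \<union> (J \<union> C)) (?old \<union> (?join \<union> ?small))"
    using A C J unfolding nonsequenceable_def directed_triple_system_iff_decomposes
    by (intro decomposes_Un) auto
  moreover have "?old \<union> (?join \<union> ?small) =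
      {(a, b). a \<in> {..<2 * v + c} \<and> b \<in> {..<2 * v + c} \<and> a \<noteq> b}"
  proof (intro equalityI subsetI)
    fix e assume e: "e \<in> ?old \<union> (?join \<union> ?small)"
    show "e \<in> {(a, b). a \<in> {..<2 * v + c} \<and> b \<in> {..<2 * v + c} \<and> a \<noteq> b}"
    proof (cases "e \<in> ?large \<union> ?small")
      case True
      then obtain i d where e': "e = (v + i, v + (i + d) mod ?n)" "i < ?n"
          and d: "c \<le> d \<or> 1 \<le> d" "d < ?n \<or> d < c"
        by blast
      have "0 < d" "d < ?n"
        using c d by linarith+
      have "(i + d) mod ?n \<noteq> (i + 0) mod ?n"
        using diff[of i d 0] \<open>0 < d\<close> \<open>d < ?n\<close> by (metis less_nat_zero_code neq0_conv)
      moreover have "(i + d) mod ?n < ?n"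
        using \<open>d < ?n\<close> by (intro mod_less_divisor) linarith
      ultimately show ?thesis
        using e' by simp
    next
      case False
      then have "e \<in> ?old \<union> ({..<v} \<times> ?Y \<union> ?Y \<times> {..<v})"
        using e by blast
      then show ?thesis
        by auto
    qed
  next
    fix e assume "e \<in> {(a, b). a \<in> {..<2 * v + c} \<and> b \<in> {..<2 * v + c} \<and> a \<noteq> b}"
    then obtain a b where e: "e = (a, b)" "a < 2 * v + c" "b < 2 * v + c" "a \<noteq> b"
      by blast
    show "e \<in> ?old \<union> (?join \<union> ?small)"
    proof (cases "a < v \<or> b < v")
      case True
      then show ?thesis
        using e by auto
    next
      case False
      obtain i j where ij: "a = v + i" "b = v + j" "i < ?n" "j < ?n"
        using False e that[of "a - v" "b - v"] by auto
      obtain d where d: "d < ?n" "(d + i) mod ?n = j"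
        using shift_surj[OF ij(4)] .
      then have "d \<noteq> 0"
        using e ij by (intro notI) simp
      then have "e = (v + i, v + (i + d) mod ?n) \<and> i < ?n \<and> 1 \<le> d \<and> d < ?n"
        using e(1) ij d by (simp add: add.commute)
      then have "e \<in> ?large \<union> ?small"
        using not_less by blast
      then show ?thesis
        by blast
    qed
  qed
  ultimately have "directed_triple_system (2 * v + c) {..<2 * v + c} (A \<union> (J \<union> C))"
    unfolding directed_triple_system_iff_decomposes by simp
  then have "nonsequenceable (2 * v + c) (A \<union> (J \<union> C))"
    by (rule nonsequenceable_extension[OF A]) auto
  then show ?thesis ..
qed

section \<open>Induction on the order\<close>

lemma ex_nonsequenceable:
  "7 \<le> v \<Longrightarrow> v mod 3 = 0 \<or> v mod 3 = 1 \<Longrightarrow> \<exists>B. nonsequenceable v B"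
proof (induction v rule: less_induct)
  case (less v)
  show ?case
  proof (cases "v \<in> {7, 9, 10, 12, 13, 16}")
    case True
    then show ?thesis
      using nonsequenceable_7 nonsequenceable_9 nonsequenceable_10 nonsequenceable_12
        nonsequenceable_13 nonsequenceable_16 by auto
  next
    case False
    obtain w c where w: "v = 2 * w + c" "c = 1 \<or> c = 4" "7 \<le> w"
    proof (cases "even v")
      case True
      then obtain u where "v = 2 * u" ..
      \<comment> \<open>The orders 8 and 14 are 2 modulo 3. With 10, 12 and 16 among the base cases,
        \<open>u\<close> is at least 9.\<close>
      moreover from this have "u \<notin> {4, 7}"
        using less.prems(2) by auto
      ultimately have "v = 2 * (u - 2) + 4" "7 \<le> u - 2"
        using False less.prems(1) by auto
      then show ?thesis
        using that by blast
    next
      case odd: False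
      then obtain u where "v = 2 * u + 1" ..
      \<comment> \<open>Order 11 is 2 modulo 3. With 7, 9 and 13 among the base cases,
        \<open>u\<close> is at least 7.\<close>
      moreover from this have "u \<noteq> 5"
        using less.prems(2) by auto
      ultimately show ?thesis
        using that[of u 1] False less.prems(1) by auto
    qed
    then have "(2 * w + c) mod 3 = 0 \<or> (2 * w + c) mod 3 = 1"
      using less.prems(2) by simp
    \<comment> \<open>Both values of \<open>c\<close> are 1 modulo 3, and \<open>2 * w + 1\<close>
      interchanges the residues 0 and 1.\<close>
    then have "w mod 3 = 0 \<or> w mod 3 = 1"
      using w(2) by (elim disjE) presburger+
    then obtain A where "nonsequenceable w A"
      using less.IH[of w] w by auto
    then show ?thesis
      using nonsequenceable_double[of w A c] w by auto
  qed
qed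

theorem theorem5p6:
  fixes v :: nat
  assumes "v \<ge> 3" and "v mod 3 = 0 \<or> v mod 3 = 1"
  shows "(v \<in> {3, 4, 6} \<longrightarrow>
            (\<forall>(X :: 'a set) B. directed_triple_system v X B \<longrightarrow> (\<exists>xs. good_sequencing X B xs))) \<and>
         (v \<ge> 7 \<longrightarrow>
            (\<exists>(X :: nat set) B. directed_triple_system v X B \<and> \<not> (\<exists>xs. good_sequencing X B xs)))"
proof (intro conjI impI allI)
  fix X :: "'a set" and B
  assume "v \<in> {3, 4, 6}" "directed_triple_system v X B"
  then show "\<exists>xs. good_sequencing X B xs"
    using good_sequencing_order_3 good_sequencing_order_4 good_sequencing_order_6 by blast
next
  assume "v \<ge> 7"
  then obtain B where "nonsequenceable v B"
    using ex_nonsequenceable[OF _ assms(2)] by blast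
  then show "\<exists>(X :: nat set) B. directed_triple_system v X B \<and> \<not> (\<exists>xs. good_sequencing X B xs)"
    unfolding nonsequenceable_def by blast
qed

end
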